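(* Let $$\Theta=\begin{pmatrix}\mathbb{A}&K&1\\ \mathcal{H}_+\subset\mathcal{H}\subset\mathcal{H}_-& &\mathbb{C}\end{pmatrix}$$ be an L-system with symmetric operator $\dot A$ whose main operator $T$ and the quasi-kernel $\hat A$ of $\operatorname{Re}\mathbb{A}$ satisfy the Hypothesis (H) (see context) with the reference operator $A=\hat A$ and the von Neumann parameter $\kappa=0$. Then $$W_\Theta(z)=-\frac{1}{s(z)},\qquad z\in\mathbb{C}_+\cap\rho(T),$$ where $s(z)$ is the Livšic function associated with the pair $(\dot A,\hat A)$.
   Context: Rigged space. $\dot A$ is a closed densely defined symmetric operator with deficiency indices $(1,1)$ in a Hilbert space $\mathcal{H}$ with inner product $(\cdot,\cdot)$ (linear in the first argument). $\mathcal{H}_+=\mathrm{Dom}(\dot A^* )$ with $(f,g)_+=(f,g)+(\dot A^*f,\dot A^*g)$; $\mathcal{H}_-$ is the space dual to $\mathcal{H}_+$ with respect to $\mathcal{H}$, so $\mathcal{H}_+\subset\mathcal{H}\subset\mathcal{H}_-$, and $(u,f)$ denotes the value of $f\in\mathcal{H}_-$ at $u\in\mathcal{H}_+$ (equal to the $\mathcal{H}$-inner product if $f\in\mathcal{H}$). $[X,Y]$ is the set of bounded linear operators $X\to Y$. Spaces dual to $\mathcal{H}_\pm$ are identified with $\mathcal{H}_\mp$, so $\mathbb{A}\in[\mathcal{H}_+,\mathcal{H}_-]$ has adjoint $\mathbb{A}^*\in[\mathcal{H}_+,\mathcal{H}_-]$; $\operatorname{Re}\mathbb{A}=(\mathbb{A}+\mathbb{A}^*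 )/2$, $\operatorname{Im}\mathbb{A}=(\mathbb{A}-\mathbb{A}^* )/(2i)$. L-systems. For $\mathbb{B}=\mathbb{B}^*\in[\mathcal{H}_+,\mathcal{H}_-]$ with $\mathbb{B}\supset\dot A$, its quasi-kernel is the restriction of $\mathbb{B}$ to $\{f\in\mathcal{H}_+:\mathbb{B}f\in\mathcal{H}\}$; $\mathbb{B}$ is a t-self-adjoint bi-extension of $\dot A$ if its quasi-kernel is a self-adjoint operator in $\mathcal{H}$. The class $\Lambda(\dot A)$ consists of operators $T$ with $\dot A\subset T\subset\dot A^*$, $\rho(T)\neq\emptyset$ and $\mathrm{Dom}(\dot A)=\mathrm{Dom}(T)\cap\mathrm{Dom}(T^* )$. A $( * )$-extension of $T\in\Lambda(\dot A)$ is $\mathbb{A}\in[\mathcal{H}_+,\mathcal{H}_-]$ with $\dot A\subset T\subset\mathbb{A}$, $\dot A\subset T^*\subset\mathbb{A}^*$ such that $\operatorname{Re}\mathbb{A}$ is a t-self-adjoint bi-extension of $\dot A$. The array $\Theta$ is an L-system (with $E=\mathbb{C}$, $J=1$) if $\mathbb{A}$ is a $( * )$-extension of some $T\in\Lambda(\dot A)$, $K\in[\mathbb{C},\mathcal{H}_-]$, $K^*\in[\mathcal{H}_+,\mathbb{C}]$, $\operatorname{Im}\mathbb{A}=KK^*$ and $\mathrm{Ran}(K)=\mathrm{Ran}(\operatorname{Im}\mathbb{A})$. $T$, the restriction of $\mathbb{A}$ to $\{f\in\mathcal{H}_+:\mathbb{A}f\in\mathcal{H}\}$, is the main operator. The transfer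 function is $W_\Theta(z)=1-2iK^*(\mathbb{A}-zI)^{-1}K$, $z\in\rho(T)$ (well defined since $\mathrm{Ran}(\mathbb{A}-zI)\supset\mathrm{Ran}(K)$). Hypothesis (H), for a triple $(\dot A,T,A)$ and a parameter $\kappa$: $T\ne T^*$ is a maximal dissipative extension of $\dot A$ (dissipative: $\operatorname{Im}(Tf,f)\ge0$ for $f\in\mathrm{Dom}(T)$), $A$ is a self-adjoint (reference) extension of $\dot A$, and there are deficiency elements $g_\pm\in\mathrm{Ker}(\dot A^*\mp iI)$, $\|g_\pm\|=1$, with $g_+-g_-\in\mathrm{Dom}(A)$ and $g_+-\kappa g_-\in\mathrm{Dom}(T)$, $|\kappa|<1$. The number $\kappa$ is called the von Neumann parameter of $T$. Livšic function. With such $g_\pm$, the Livšic function of $(\dot A,A)$ is $s(z)=\frac{z-i}{z+i}\cdot\frac{(g_z,g_-)}{(g_z,g_+)}$, $z\in\mathbb{C}_+$, where $0\ne g_z\in\mathrm{Ker}(\dot A^*-zI)$ is arbitrary. *)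

theory Defs
  imports "HOL-Analysis.Analysis"
begin

section \<open>Complex Hilbert spaces\<close>

text \<open>The inner product is linear in the first and antilinear in the second argument.\<close>

class complex_hilbert_space = banach +
  fixes scaleC :: "complex \<Rightarrow> 'a \<Rightarrow> 'a"  (infixr "*\<^sub>C" 75)
    and cinner :: "'a \<Rightarrow> 'a \<Rightarrow> complex"
  assumes scaleC_add_right: "c *\<^sub>C (x + y) = c *\<^sub>C x + c *\<^sub>C y"
    and scaleC_add_left: "(c + d) *\<^sub>C x = c *\<^sub>C x + d *\<^sub>C x"
    and scaleC_scaleC: "c *\<^sub>C (d *\<^sub>C x) = (c * d) *\<^sub>C x"
    and scaleR_scaleC: "scaleR r x = complex_of_real r *\<^sub>C x"
    and cinner_commute: "cinner x y = cnj (cinner y x)"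
    and cinner_add_left: "cinner (x + y) z = cinner x z + cinner y z"
    and cinner_scaleC_left: "cinner (c *\<^sub>C x) y = c * cinner x y"
    and cinner_same: "cinner x x = complex_of_real ((norm x)\<^sup>2)"

interpretation complex_vector: vector_space "scaleC :: complex \<Rightarrow> 'a \<Rightarrow> 'a::complex_hilbert_space"
proof
  show "1 *\<^sub>C x = x" for x :: 'a
    using scaleR_scaleC[of 1 x] by simp
qed (simp_all add: scaleC_add_right scaleC_add_left scaleC_scaleC)

section \<open>Unbounded operators\<close>

text \<open>An operator is given by its graph, so that \<open>A \<subseteq> T\<close> says that \<open>T\<close> extends \<open>A\<close>, and
  \<open>Domain A\<close> is the domain of \<open>A\<close>.\<close>

type_synonym 'a operator = "('a \<times> 'a) set"

definition linear_operator :: "'a::complex_hilbert_space operator \<Rightarrow> bool" where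
  "linear_operator A \<longleftrightarrow>
     (0, 0) \<in> A \<and>
     (\<forall>f g h k. (f, g) \<in> A \<longrightarrow> (h, k) \<in> A \<longrightarrow> (f + h, g + k) \<in> A) \<and>
     (\<forall>c f g. (f, g) \<in> A \<longrightarrow> (c *\<^sub>C f, c *\<^sub>C g) \<in> A) \<and>
     single_valued A"

definition densely_defined :: "'a::complex_hilbert_space operator \<Rightarrow> bool" where
  "densely_defined A \<longleftrightarrow> closure (Domain A) = UNIV"

definition apply_op :: "'a operator \<Rightarrow> 'a \<Rightarrow> 'a" where
  "apply_op A f = (THE g. (f, g) \<in> A)"

definition adj :: "'a::complex_hilbert_space operator \<Rightarrow> 'a operator" where
  "adj A = {(h, k). \<forall>(f, g) \<in> A. cinner g h = cinner f k}"

definition symmetric_operator :: "'a::complex_hilbert_space operator \<Rightarrow> bool" where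
  "symmetric_operator A \<longleftrightarrow>
     linear_operator A \<and> (\<forall>(f, g) \<in> A. \<forall>(h, k) \<in> A. cinner g h = cinner f k)"

definition self_adjoint :: "'a::complex_hilbert_space operator \<Rightarrow> bool" where
  "self_adjoint A \<longleftrightarrow> linear_operator A \<and> densely_defined A \<and> adj A = A"

definition dissipative :: "'a::complex_hilbert_space operator \<Rightarrow> bool" where
  "dissipative T \<longleftrightarrow> linear_operator T \<and> (\<forall>(f, g) \<in> T. Im (cinner g f) \<ge> 0)"

definition maximal_dissipative_extension ::
    "'a::complex_hilbert_space operator \<Rightarrow> 'a operator \<Rightarrow> bool" where
  "maximal_dissipative_extension Adot T \<longleftrightarrow>
     Adot \<subseteq> T \<and> dissipative T \<and> (\<forall>S. dissipative S \<longrightarrow> T \<subseteq> S \<longrightarrow> S = T)"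

text \<open>\<open>T - z I\<close> is a bijection from the domain of \<open>T\<close> onto the whole space, with bounded inverse.\<close>

definition resolvent_set :: "'a::complex_hilbert_space operator \<Rightarrow> complex set" where
  "resolvent_set T =
     {z. (\<forall>h. \<exists>!f. (f, h + z *\<^sub>C f) \<in> T) \<and>
         (\<exists>M. \<forall>(f, g) \<in> T. norm f \<le> M * norm (g - z *\<^sub>C f))}"

text \<open>\<open>Ker (A\<^sup>* - z I)\<close>\<close>

definition deficiency_space :: "'a::complex_hilbert_space operator \<Rightarrow> complex \<Rightarrow> 'a set" where
  "deficiency_space A z = {g. (g, z *\<^sub>C g) \<in> adj A}"

text \<open>Since \<open>dim\<close> is 0 for infinite-dimensional spaces, the value 1 does mean one-dimensional.\<close>

definition deficiency_indices_1_1 :: "'a::complex_hilbert_space operator \<Rightarrow> bool" where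
  "deficiency_indices_1_1 A \<longleftrightarrow>
     complex_vector.dim (deficiency_space A \<i>) = 1 \<and>
     complex_vector.dim (deficiency_space A (- \<i>)) = 1"

section \<open>The rigged space\<close>

definition Hplus :: "'a::complex_hilbert_space operator \<Rightarrow> 'a set" where
  "Hplus Adot = Domain (adj Adot)"

definition plus_inner :: "'a::complex_hilbert_space operator \<Rightarrow> 'a \<Rightarrow> 'a \<Rightarrow> complex" where
  "plus_inner Adot f g =
     cinner f g + cinner (apply_op (adj Adot) f) (apply_op (adj Adot) g)"

definition plus_norm :: "'a::complex_hilbert_space operator \<Rightarrow> 'a \<Rightarrow> real" where
  "plus_norm Adot f = sqrt (Re (plus_inner Adot f f))"

text \<open>In the pairing \<open>(u, \<phi>)\<close> of \<open>u \<in> H\<^sub>+\<close> with \<open>\<phi> \<in> H\<^sub>-\<close>, which extends the inner product,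
  \<open>(u, \<phi>)\<close> is antilinear in \<open>\<phi>\<close>.  We therefore represent \<open>\<phi> \<in> H\<^sub>-\<close> by the bounded antilinear
  functional \<open>\<phi> u = (\<phi>, u) = cnj (u, \<phi>)\<close> on \<open>H\<^sub>+\<close>, so that the vector space operations of \<open>H\<^sub>-\<close>
  are the pointwise ones and \<open>h \<in> H\<close> is embedded linearly as \<open>\<lambda>u. (h, u)\<close>.
  Functionals are set to 0 outside \<open>H\<^sub>+\<close>, so that equality in \<open>H\<^sub>-\<close> is equality of functions.\<close>

definition Hminus :: "'a::complex_hilbert_space operator \<Rightarrow> ('a \<Rightarrow> complex) set" where
  "Hminus Adot =
     {\<phi>. (\<forall>u. u \<notin> Hplus Adot \<longrightarrow> \<phi> u = 0) \<and>
         (\<forall>u\<in>Hplus Adot. \<forall>v\<in>Hplus Adot. \<phi> (u + v) = \<phi> u + \<phi> v) \<and>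
         (\<forall>c. \<forall>u\<in>Hplus Adot. \<phi> (c *\<^sub>C u) = cnj c * \<phi> u) \<and>
         (\<exists>M. \<forall>u\<in>Hplus Adot. cmod (\<phi> u) \<le> M * plus_norm Adot u)}"

definition minus_norm ::
    "'a::complex_hilbert_space operator \<Rightarrow> ('a \<Rightarrow> complex) \<Rightarrow> real" where
  "minus_norm Adot \<phi> = Sup {cmod (\<phi> u) | u. u \<in> Hplus Adot \<and> plus_norm Adot u \<le> 1}"

definition emb :: "'a::complex_hilbert_space operator \<Rightarrow> 'a \<Rightarrow> 'a \<Rightarrow> complex" where
  "emb Adot h = (\<lambda>u. if u \<in> Hplus Adot then cinner h u else 0)"

text \<open>\<open>[H\<^sub>+, H\<^sub>-]\<close>; the values of \<open>B\<close> outside \<open>H\<^sub>+\<close> are irrelevant.\<close>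

definition bounded_plus_minus ::
    "'a::complex_hilbert_space operator \<Rightarrow> ('a \<Rightarrow> 'a \<Rightarrow> complex) set" where
  "bounded_plus_minus Adot =
     {B. (\<forall>f\<in>Hplus Adot. B f \<in> Hminus Adot) \<and>
         (\<forall>f\<in>Hplus Adot. \<forall>g\<in>Hplus Adot. B (f + g) = (\<lambda>u. B f u + B g u)) \<and>
         (\<forall>c. \<forall>f\<in>Hplus Adot. B (c *\<^sub>C f) = (\<lambda>u. c * B f u)) \<and>
         (\<exists>M. \<forall>f\<in>Hplus Adot. minus_norm Adot (B f) \<le> M * plus_norm Adot f)}"

text \<open>The adjoint is given by \<open>(B u, f) = (u, B\<^sup>* f)\<close> for \<open>u, f \<in> H\<^sub>+\<close>, where the left side is
  \<open>B u f\<close> and the right side is \<open>cnj (B\<^sup>* f u)\<close>.\<close>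

definition bi_adj ::
    "'a::complex_hilbert_space operator \<Rightarrow> ('a \<Rightarrow> 'a \<Rightarrow> complex) \<Rightarrow> 'a \<Rightarrow> 'a \<Rightarrow> complex" where
  "bi_adj Adot B f = (\<lambda>u. if f \<in> Hplus Adot \<and> u \<in> Hplus Adot then cnj (B u f) else 0)"

definition bi_Re ::
    "'a::complex_hilbert_space operator \<Rightarrow> ('a \<Rightarrow> 'a \<Rightarrow> complex) \<Rightarrow> 'a \<Rightarrow> 'a \<Rightarrow> complex" where
  "bi_Re Adot B f = (\<lambda>u. (B f u + bi_adj Adot B f u) / 2)"

definition bi_Im ::
    "'a::complex_hilbert_space operator \<Rightarrow> ('a \<Rightarrow> 'a \<Rightarrow> complex) \<Rightarrow> 'a \<Rightarrow> 'a \<Rightarrow> complex" where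
  "bi_Im Adot B f = (\<lambda>u. (B f u - bi_adj Adot B f u) / (2 * \<i>))"

text \<open>\<open>T \<subset> B\<close> for an operator \<open>T\<close> in \<open>H\<close> and \<open>B \<in> [H\<^sub>+, H\<^sub>-]\<close>.\<close>

definition bi_extends ::
    "'a::complex_hilbert_space operator \<Rightarrow> ('a \<Rightarrow> 'a \<Rightarrow> complex) \<Rightarrow> 'a operator \<Rightarrow> bool" where
  "bi_extends Adot B T \<longleftrightarrow> (\<forall>(f, g) \<in> T. f \<in> Hplus Adot \<and> B f = emb Adot g)"

definition quasi_kernel ::
    "'a::complex_hilbert_space operator \<Rightarrow> ('a \<Rightarrow> 'a \<Rightarrow> complex) \<Rightarrow> 'a operator" where
  "quasi_kernel Adot B = {(f, g). f \<in> Hplus Adot \<and> B f = emb Adot g}"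

definition t_self_adjoint_bi_extension ::
    "'a::complex_hilbert_space operator \<Rightarrow> ('a \<Rightarrow> 'a \<Rightarrow> complex) \<Rightarrow> bool" where
  "t_self_adjoint_bi_extension Adot B \<longleftrightarrow>
     B \<in> bounded_plus_minus Adot \<and>
     (\<forall>f\<in>Hplus Adot. bi_adj Adot B f = B f) \<and>
     bi_extends Adot B Adot \<and>
     self_adjoint (quasi_kernel Adot B)"

section \<open>L-systems\<close>

definition class_Lambda ::
    "'a::complex_hilbert_space operator \<Rightarrow> 'a operator set" where
  "class_Lambda Adot =
     {T. linear_operator T \<and> Adot \<subseteq> T \<and> T \<subseteq> adj Adot \<and> resolvent_set T \<noteq> {} \<and>
         Domain Adot = Domain T \<inter> Domain (adj T)}"

definition star_extension ::
    "'a::complex_hilbert_space operator \<Rightarrow> 'a operator \<Rightarrow> ('a \<Rightarrow> 'a \<Rightarrow> complex) \<Rightarrow> bool" where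
  "star_extension Adot T AA \<longleftrightarrow>
     AA \<in> bounded_plus_minus Adot \<and>
     Adot \<subseteq> T \<and> bi_extends Adot AA T \<and>
     Adot \<subseteq> adj T \<and> bi_extends Adot (bi_adj Adot AA) (adj T) \<and>
     t_self_adjoint_bi_extension Adot (bi_Re Adot AA)"

text \<open>\<open>[\<complex>, H\<^sub>-]\<close> and \<open>[H\<^sub>+, \<complex>]\<close>\<close>

definition bounded_complex_minus ::
    "'a::complex_hilbert_space operator \<Rightarrow> (complex \<Rightarrow> 'a \<Rightarrow> complex) set" where
  "bounded_complex_minus Adot =
     {K. (\<forall>c. K c \<in> Hminus Adot) \<and>
         (\<forall>c d. K (c + d) = (\<lambda>u. K c u + K d u)) \<and>
         (\<forall>c d. K (c * d) = (\<lambda>u. c * K d u)) \<and>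
         (\<exists>M. \<forall>c. minus_norm Adot (K c) \<le> M * cmod c)}"

definition bounded_plus_complex ::
    "'a::complex_hilbert_space operator \<Rightarrow> ('a \<Rightarrow> complex) set" where
  "bounded_plus_complex Adot =
     {F. (\<forall>f\<in>Hplus Adot. \<forall>g\<in>Hplus Adot. F (f + g) = F f + F g) \<and>
         (\<forall>c. \<forall>f\<in>Hplus Adot. F (c *\<^sub>C f) = c * F f) \<and>
         (\<exists>M. \<forall>f\<in>Hplus Adot. cmod (F f) \<le> M * plus_norm Adot f)}"

text \<open>The adjoint is given by \<open>(K c, u) = c * cnj (K\<^sup>* u)\<close> for \<open>c \<in> \<complex>\<close> and \<open>u \<in> H\<^sub>+\<close>;
  see the lemma below.\<close>

definition channel_adj :: "(complex \<Rightarrow> 'a \<Rightarrow> complex) \<Rightarrow> 'a \<Rightarrow> complex" where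
  "channel_adj K u = cnj (K 1 u)"

lemma channel_adj_iff:
  assumes "K \<in> bounded_complex_minus Adot"
  shows "(\<forall>c. K c u = c * cnj w) \<longleftrightarrow> w = channel_adj K u"
proof -
  have "K c u = c * K 1 u" for c
    using assms mult.right_neutral[of c]
    unfolding bounded_complex_minus_def mem_Collect_eq by metis
  then show ?thesis
    by (metis channel_adj_def complex_cnj_cnj mult_1)
qed

definition L_system ::
    "'a::complex_hilbert_space operator \<Rightarrow> ('a \<Rightarrow> 'a \<Rightarrow> complex) \<Rightarrow>
     (complex \<Rightarrow> 'a \<Rightarrow> complex) \<Rightarrow> bool" where
  "L_system Adot AA K \<longleftrightarrow>
     (\<exists>T\<in>class_Lambda Adot. star_extension Adot T AA) \<and>
     K \<in> bounded_complex_minus Adot \<and>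
     channel_adj K \<in> bounded_plus_complex Adot \<and>
     (\<forall>f\<in>Hplus Adot. bi_Im Adot AA f = K (channel_adj K f)) \<and>
     range K = bi_Im Adot AA ` Hplus Adot"

definition main_operator ::
    "'a::complex_hilbert_space operator \<Rightarrow> ('a \<Rightarrow> 'a \<Rightarrow> complex) \<Rightarrow> 'a operator" where
  "main_operator Adot AA = {(f, g). f \<in> Hplus Adot \<and> AA f = emb Adot g}"

text \<open>\<open>(AA - z I)\<^sup>-\<^sup>1 \<phi>\<close>\<close>

definition bi_resolvent ::
    "'a::complex_hilbert_space operator \<Rightarrow> ('a \<Rightarrow> 'a \<Rightarrow> complex) \<Rightarrow> complex \<Rightarrow>
     ('a \<Rightarrow> complex) \<Rightarrow> 'a" where
  "bi_resolvent Adot AA z \<phi> =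
     (THE f. f \<in> Hplus Adot \<and> (\<lambda>u. AA f u - z * emb Adot f u) = \<phi>)"

text \<open>The operator \<open>1 - 2 \<i> K\<^sup>* (AA - z I)\<^sup>-\<^sup>1 K\<close> on \<open>\<complex>\<close>, identified with its value at 1.\<close>

definition transfer_function ::
    "'a::complex_hilbert_space operator \<Rightarrow> ('a \<Rightarrow> 'a \<Rightarrow> complex) \<Rightarrow>
     (complex \<Rightarrow> 'a \<Rightarrow> complex) \<Rightarrow> complex \<Rightarrow> complex" where
  "transfer_function Adot AA K z =
     1 - 2 * \<i> * channel_adj K (bi_resolvent Adot AA z (K 1))"

section \<open>Hypothesis (H) and the Livsic function\<close>

definition normalized_deficiency_pair ::
    "'a::complex_hilbert_space operator \<Rightarrow> 'a operator \<Rightarrow> 'a \<Rightarrow> 'a \<Rightarrow> bool" where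
  "normalized_deficiency_pair Adot A gp gm \<longleftrightarrow>
     gp \<in> deficiency_space Adot \<i> \<and> gm \<in> deficiency_space Adot (- \<i>) \<and>
     norm gp = 1 \<and> norm gm = 1 \<and> gp - gm \<in> Domain A"

definition hypothesis_H ::
    "'a::complex_hilbert_space operator \<Rightarrow> 'a operator \<Rightarrow> 'a operator \<Rightarrow> complex \<Rightarrow> bool" where
  "hypothesis_H Adot T A \<kappa> \<longleftrightarrow>
     T \<noteq> adj T \<and> maximal_dissipative_extension Adot T \<and>
     self_adjoint A \<and> Adot \<subseteq> A \<and>
     (\<exists>gp gm. normalized_deficiency_pair Adot A gp gm \<and> gp - \<kappa> *\<^sub>C gm \<in> Domain T) \<and>
     cmod \<kappa> < 1"

text \<open>The value is the same for all admissible \<open>gp\<close>, \<open>gm\<close> (they are unique up to a common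
  unimodular factor) and all nonzero \<open>gz\<close>; the description expresses this independence.\<close>

definition livsic ::
    "'a::complex_hilbert_space operator \<Rightarrow> 'a operator \<Rightarrow> complex \<Rightarrow> complex" where
  "livsic Adot A z =
     (THE s. \<forall>gp gm gz. normalized_deficiency_pair Adot A gp gm \<longrightarrow>
        gz \<in> deficiency_space Adot z \<longrightarrow> gz \<noteq> 0 \<longrightarrow>
        s = (z - \<i>) / (z + \<i>) * (cinner gz gm / cinner gz gp))"

end

theory Submission
  imports Defs
begin

text \<open>Write \<open>k = K 1\<close>.  Since \<open>Ahat - \<i>\<close> is onto, every \<open>f \<in> H\<^sub>+\<close> lies in
  \<open>Dom Ahat + span gp\<close>, hence \<open>AA f = A\<^sup>* f + c k\<close> for some number \<open>c\<close>.  In particular, for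
  \<open>z \<in> \<rho>(T)\<close> every nonzero \<open>g\<^sub>z\<close> has a multiple \<open>f\<close> that solves \<open>(AA - z) f = k\<close>.  Since
  \<open>\<kappa> = 0\<close>, \<open>gp \<in> Dom T\<close>, so \<open>AA gp = \<i> gp\<close>, while \<open>Re AA (gp - gm) = \<i> (gp + gm)\<close>.  Testing the
  equation for \<open>f\<close> against \<open>gp\<close> and \<open>gp - gm\<close> gives \<open>- (z + \<i>) (f, gp) = k gp W(z)\<close> and
  \<open>(z - \<i>) (f, gm) = k gp \<noteq> 0\<close>; their quotient is the claim.\<close>

section \<open>Complex inner products\<close>

lemma cinner_add_right: "cinner x (y + z) = cinner x y + cinner x z"
  by (metis cinner_add_left cinner_commute complex_cnj_add)

lemma cinner_scaleC_right: "cinner x (c *\<^sub>C y) = cnj c * cinner x y"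
  by (metis cinner_commute cinner_scaleC_left complex_cnj_mult)

lemma cinner_diff_left: "cinner (x - y) z = cinner x z - cinner y z"
  using cinner_add_left[of "x - y" y z] by simp

lemma cinner_diff_right: "cinner x (y - z) = cinner x y - cinner x z"
  using cinner_add_right[of x "y - z" z] by simp

lemma cinner_zero_left [simp]: "cinner 0 x = 0"
  using cinner_add_left[of 0 0 x] by simp

lemma cinner_zero_right [simp]: "cinner x 0 = 0"
  using cinner_add_right[of x 0 0] by simp

lemmas cinner_simps =
  cinner_add_left cinner_add_right cinner_diff_left cinner_diff_right
  cinner_scaleC_left cinner_scaleC_right

lemma norm_add_sq: "(norm (x + y))\<^sup>2 = (norm x)\<^sup>2 + (norm y)\<^sup>2 + 2 * Re (cinner x y)"
proof -
  have "complex_of_real ((norm (x + y))\<^sup>2)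
      = of_real ((norm x)\<^sup>2) + of_real ((norm y)\<^sup>2) + (cinner x y + cnj (cinner x y))"
    by (simp only: cinner_same[symmetric] cinner_commute[of x y, symmetric] cinner_simps)
      (simp flip: cinner_commute)
  also have "\<dots> = of_real ((norm x)\<^sup>2 + (norm y)\<^sup>2 + 2 * Re (cinner x y))"
    by (simp add: complex_add_cnj)
  finally show ?thesis
    by (simp only: of_real_eq_iff)
qed

lemma norm_scaleC: "norm (c *\<^sub>C x) = cmod c * norm x"
proof -
  have "complex_of_real ((norm (c *\<^sub>C x))\<^sup>2) = of_real ((cmod c * norm x)\<^sup>2)"
    by (simp only: cinner_same[symmetric] cinner_simps)
      (simp add: cinner_same power_mult_distrib complex_norm_square mult_ac del: of_real_power)
  then show ?thesis
    by (simp only: of_real_eq_iff) (simp add: power2_eq_iff_nonneg)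
qed

text \<open>This expansion serves the minimality argument, Cauchy-Schwarz, the parallelogram law and
  the lower bound for \<open>A - \<i>\<close>.\<close>

lemma norm_diff_scaleC_sq:
  "(norm (x - c *\<^sub>C y))\<^sup>2 = (norm x)\<^sup>2 + (cmod c)\<^sup>2 * (norm y)\<^sup>2 - 2 * Re (c * cinner y x)"
proof -
  have "x - c *\<^sub>C y = x + (- c) *\<^sub>C y"
    by (simp add: complex_vector.scale_minus_left)
  moreover have "Re (cinner x ((- c) *\<^sub>C y)) = - Re (c * cinner y x)"
    by (subst cinner_commute) (simp add: cinner_simps del: complex_vector.scale_minus_left)
  ultimately show ?thesis
    by (simp only: norm_add_sq norm_scaleC power_mult_distrib norm_minus_cancel)
qed

lemma orthogonal_if_minimal:
  assumes "\<And>c. norm x \<le> norm (x - c *\<^sub>C y)"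
  shows "cinner y x = 0"
proof -
  define a where "a = cinner y x"
  \<comment> \<open>A step of length \<open>t\<close> in the direction \<open>cnj a\<close> gains
    \<open>2 * t * (cmod a)\<^sup>2\<close> and costs at most half of it, since
    \<open>t * (norm y)\<^sup>2\<close> is at most 1. The summand 1 in the denominator also covers
    \<open>y = 0\<close>.\<close>
  define t where "t = 1 / ((norm y)\<^sup>2 + 1)"
  have pos: "(norm y)\<^sup>2 + 1 > 0"
    by (smt (verit) zero_le_power2)
  have t: "t > 0" "t * (norm y)\<^sup>2 \<le> 1"
    using pos by (auto simp: t_def field_simps)
  have "(norm x)\<^sup>2 \<le> (norm (x - (of_real t * cnj a) *\<^sub>C y))\<^sup>2"
    using assms by (simp add: power_mono)
  moreover have "Re (of_real t * cnj a * a) = t * (cmod a)\<^sup>2"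
    using complex_norm_square[of a] by (metis Re_complex_of_real mult.assoc mult.commute of_real_mult)
  ultimately have "2 * (t * (cmod a)\<^sup>2) \<le> (t * cmod a)\<^sup>2 * (norm y)\<^sup>2"
    using t by (simp add: norm_diff_scaleC_sq norm_mult flip: a_def)
  also have "\<dots> = (t * (norm y)\<^sup>2) * (t * (cmod a)\<^sup>2)"
    by (simp add: power2_eq_square)
  also have "\<dots> \<le> 1 * (t * (cmod a)\<^sup>2)"
    using t by (intro mult_right_mono) auto
  finally have "t * (cmod a)\<^sup>2 \<le> 0"
    by simp
  then show ?thesis
    using t by (simp add: mult_le_0_iff a_def)
qed

lemma Cauchy_Schwarz_cinner: "cmod (cinner y x) \<le> norm y * norm x"
proof (cases "y = 0")
  case False
  \<comment> \<open>With this \<open>c\<close>, \<open>c *\<^sub>C y\<close> is the orthogonal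
    projection of \<open>x\<close> onto the line through \<open>y\<close>.\<close>
  define a c where "a = cinner y x" and "c = cnj a / of_real ((norm y)\<^sup>2)"
  have "Re (c * a) = (cmod a)\<^sup>2 / (norm y)\<^sup>2"
  proof -
    have "c * a = of_real ((cmod a)\<^sup>2 / (norm y)\<^sup>2)"
      using complex_norm_square[of a] by (simp add: c_def mult.commute)
    then show ?thesis by (metis Re_complex_of_real)
  qed
  moreover have "(cmod c)\<^sup>2 * (norm y)\<^sup>2 = (cmod a)\<^sup>2 / (norm y)\<^sup>2"
    using False by (simp add: c_def norm_divide power_divide norm_mult norm_power field_simps power2_eq_square
        flip: of_real_mult)
  moreover have "0 \<le> (norm (x - c *\<^sub>C y))\<^sup>2"
    by simp
  ultimately have "(cmod a)\<^sup>2 / (norm y)\<^sup>2 \<le> (norm x)\<^sup>2"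
    by (simp add: norm_diff_scaleC_sq flip: a_def)
  then have "(cmod a)\<^sup>2 \<le> (norm y * norm x)\<^sup>2"
    using False by (simp add: field_simps)
  then show ?thesis
    unfolding a_def by (rule power2_le_imp_le) simp
qed simp

lemma tendsto_cinner_left:
  assumes "f \<longlonglongrightarrow> l"
  shows "(\<lambda>n. cinner (f n) y) \<longlonglongrightarrow> cinner l y"
proof -
  have "(\<lambda>n. norm (f n - l) * norm y) \<longlonglongrightarrow> 0"
    using tendsto_mult_left_zero[OF tendsto_norm_zero[OF LIM_zero[OF assms]]] .
  then have "(\<lambda>n. cinner (f n - l) y) \<longlonglongrightarrow> 0"
    by (rule Lim_null_comparison[rotated]) (simp add: Cauchy_Schwarz_cinner)
  then show ?thesis
    by (simp add: cinner_diff_left LIM_zero_iff)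
qed

lemma tendsto_cinner_right:
  assumes "f \<longlonglongrightarrow> l"
  shows "(\<lambda>n. cinner y (f n)) \<longlonglongrightarrow> cinner y l"
  using tendsto_cnj[OF tendsto_cinner_left[OF assms, of y]] by (simp flip: cinner_commute)

section \<open>Density, closest points and orthogonal complements\<close>

lemma orthogonal_dense_eq_0:
  assumes "closure S = UNIV" and "\<And>u. u \<in> S \<Longrightarrow> cinner u w = 0"
  shows "w = 0"
proof -
  obtain s where s: "\<And>n. s n \<in> S" "s \<longlonglongrightarrow> w"
    using assms(1) closure_sequential[of w S] by auto
  then have "(\<lambda>n. cinner (s n) w) \<longlonglongrightarrow> cinner w w"
    by (intro tendsto_cinner_left)
  then have "cinner w w = 0"
    using s(1) assms(2) by (simp add: LIMSEQ_const_iff)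
  then show ?thesis
    by (simp add: cinner_same)
qed

text \<open>This is the parallelogram law for \<open>x - a\<close> and \<open>x - b\<close>, whose
  sum is twice the vector from the midpoint of \<open>a\<close> and \<open>b\<close> to
  \<open>x\<close>.\<close>

lemma parallelogram_midpoint:
  "(norm (a - b))\<^sup>2 = 2 * (norm (x - a))\<^sup>2 + 2 * (norm (x - b))\<^sup>2
     - 4 * (norm (x - (1/2) *\<^sub>C (a + b)))\<^sup>2" for x :: "'a::complex_hilbert_space"
proof -
  define p q where "p = x - a" and "q = x - b"
  have half: "2 *\<^sub>C (1/2) *\<^sub>C y = y" for y :: 'a
    by (simp add: scaleC_scaleC)
  have two: "2 *\<^sub>C y = y + y" for y :: 'a
    using scaleC_add_left[of 1 1 y] by simp
  have "2 *\<^sub>C (x - (1/2) *\<^sub>C (a + b)) = p + q"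
    by (simp add: complex_vector.scale_right_diff_distrib half two[of x] p_def q_def)
  then have "(norm (p + q))\<^sup>2 = 4 * (norm (x - (1/2) *\<^sub>C (a + b)))\<^sup>2"
    using norm_scaleC[of 2 "x - (1/2) *\<^sub>C (a + b)"] by (simp add: power_mult_distrib)
  \<comment> \<open>The coefficient 1 is kept so that \<open>norm_diff_scaleC_sq\<close>
    matches.\<close>
  moreover have "norm (a - b) = norm (p - 1 *\<^sub>C q)"
    by (simp add: p_def q_def norm_minus_commute)
  moreover have "Re (cinner q p) = Re (cinner p q)"
    using cinner_commute[of p q] by simp
  ultimately show ?thesis
    by (simp add: norm_diff_scaleC_sq norm_add_sq p_def[symmetric] q_def[symmetric]
        del: complex_vector.scale_one)
qed

lemma closed_subspace_closest_point:
  fixes M :: "'a::complex_hilbert_space set"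
  assumes "closed M" and sub: "complex_vector.subspace M"
  obtains m where "m \<in> M" and "\<And>n. n \<in> M \<Longrightarrow> norm (x - m) \<le> norm (x - n)"
proof -
  have ne: "M \<noteq> {}"
    using sub complex_vector.subspace_0 by blast
  define d where "d = infdist x M"
  have d: "0 \<le> d" "n \<in> M \<Longrightarrow> d \<le> norm (x - n)" for n
    unfolding d_def using infdist_le[of n M x] by (auto simp: infdist_nonneg dist_norm)
  have "\<exists>m\<in>M. (norm (x - m))\<^sup>2 < d\<^sup>2 + 1 / Suc n" for n
  proof -
    have "d < sqrt (d\<^sup>2 + 1 / Suc n)"
      by (rule real_less_rsqrt) simp
    then obtain m where "m \<in> M" "dist x m < sqrt (d\<^sup>2 + 1 / Suc n)"
      unfolding d_def infdist_def using ne
      by (auto simp: cINF_less_iff)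
    then have "(norm (x - m))\<^sup>2 < (sqrt (d\<^sup>2 + 1 / Suc n))\<^sup>2"
      by (intro power_strict_mono) (auto simp: dist_norm)
    then show ?thesis
      using \<open>m \<in> M\<close> by auto
  qed
  then obtain s where s: "\<And>n. s n \<in> M" "\<And>n. (norm (x - s n))\<^sup>2 < d\<^sup>2 + 1 / Suc n"
    by metis
  \<comment> \<open>Midpoints stay in \<open>M\<close>, so their distance to \<open>x\<close> is at
    least \<open>d\<close>; in the parallelogram law the terms \<open>4 * d\<^sup>2\<close> cancel
    and only the errors remain.\<close>
  have close: "(norm (s i - s j))\<^sup>2 \<le> 2 / Suc i + 2 / Suc j" for i j
  proof -
    have "(1/2) *\<^sub>C (s i + s j) \<in> M"
      using s sub by (intro complex_vector.subspace_scale complex_vector.subspace_add)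
    then have "d\<^sup>2 \<le> (norm (x - (1/2) *\<^sub>C (s i + s j)))\<^sup>2"
      using d by (intro power_mono)
    then show ?thesis
      using parallelogram_midpoint[of "s i" "s j" x] s(2)[of i] s(2)[of j] by simp
  qed
  have "Cauchy s"
  proof (rule CauchyI)
    fix e :: real
    assume "0 < e"
    then obtain N where N: "1 / real (Suc N) < e\<^sup>2 / 4"
      using nat_approx_posE[of "e\<^sup>2 / 4"] by auto
    have "norm (s i - s j) < e" if "N \<le> i" "N \<le> j" for i j
    proof -
      have "1 / real (Suc i) \<le> 1 / real (Suc N)" "1 / real (Suc j) \<le> 1 / real (Suc N)"
        using that by (auto simp: frac_le)
      then have "(norm (s i - s j))\<^sup>2 < e\<^sup>2"
        using close[of i j] N by simp
      then show ?thesis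
        using \<open>0 < e\<close> by (simp add: power_less_imp_less_base)
    qed
    then show "\<exists>N. \<forall>i\<ge>N. \<forall>j\<ge>N. norm (s i - s j) < e"
      by blast
  qed
  then obtain m where m: "s \<longlonglongrightarrow> m"
    using Cauchy_convergent convergent_def by blast
  have "m \<in> M"
    using closed_sequentially[OF \<open>closed M\<close>] s m by blast
  have "(norm (x - m))\<^sup>2 \<le> d\<^sup>2"
  proof (rule LIMSEQ_le)
    show "(\<lambda>n. (norm (x - s n))\<^sup>2) \<longlonglongrightarrow> (norm (x - m))\<^sup>2"
      by (intro tendsto_intros m)
    show "(\<lambda>n. d\<^sup>2 + 1 / Suc n) \<longlonglongrightarrow> d\<^sup>2"
      using tendsto_add[OF tendsto_const[of "d\<^sup>2"] LIMSEQ_inverse_real_of_nat]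
      by (simp add: inverse_eq_divide)
  qed (use s in \<open>auto intro!: less_imp_le\<close>)
  then have "norm (x - m) \<le> d"
    using d(1) by (simp add: power2_le_iff_abs_le)
  then show ?thesis
    using that \<open>m \<in> M\<close> d(2) by (meson order_trans)
qed

text \<open>The difference of \<open>x\<close> and its closest point in \<open>M\<close> is
  orthogonal to \<open>M\<close>, hence 0.\<close>

lemma closed_subspace_eq_UNIV:
  fixes M :: "'a::complex_hilbert_space set"
  assumes "closed M" and sub: "complex_vector.subspace M"
    and orth: "\<And>w. (\<And>m. m \<in> M \<Longrightarrow> cinner m w = 0) \<Longrightarrow> w = 0"
  shows "M = UNIV"
proof -
  have "x \<in> M" for x
  proof -
    obtain m where m: "m \<in> M" "\<And>n. n \<in> M \<Longrightarrow> norm (x - m) \<le> norm (x - n)"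
      using closed_subspace_closest_point[OF assms(1) sub] by blast
    have "cinner n (x - m) = 0" if "n \<in> M" for n
    proof (rule orthogonal_if_minimal)
      show "norm (x - m) \<le> norm (x - m - c *\<^sub>C n)" for c
        using m(2)[of "m + c *\<^sub>C n"] m(1) that sub
        by (simp add: complex_vector.subspace_add complex_vector.subspace_scale algebra_simps)
    qed
    then show ?thesis
      using orth[of "x - m"] m(1) by simp
  qed
  then show ?thesis
    by blast
qed

section \<open>Adjoints and self-adjoint operators\<close>

lemma adjD: "(h, k) \<in> adj A \<Longrightarrow> (f, g) \<in> A \<Longrightarrow> cinner g h = cinner f k"
  unfolding adj_def by blast

lemma adj_diff: "(f, g) \<in> adj A \<Longrightarrow> (h, k) \<in> adj A \<Longrightarrow> (f - h, g - k) \<in> adj A"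
  unfolding adj_def by (fastforce simp: cinner_simps)

lemma adj_scaleC: "(f, g) \<in> adj A \<Longrightarrow> (c *\<^sub>C f, c *\<^sub>C g) \<in> adj A"
  unfolding adj_def by (auto simp: cinner_simps)

lemma adj_antimono: "A \<subseteq> B \<Longrightarrow> adj B \<subseteq> adj A"
  unfolding adj_def by blast

lemma adj_single_valued:
  assumes "densely_defined A" and "(f, g) \<in> adj A" and "(f, g') \<in> adj A"
  shows "g = g'"
proof -
  have "g - g' = 0"
  proof (rule orthogonal_dense_eq_0)
    show "closure (Domain A) = UNIV"
      using assms(1) by (simp add: densely_defined_def)
    show "cinner u (g - g') = 0" if "u \<in> Domain A" for u
      using that adjD[OF assms(2)] adjD[OF assms(3)] by (force simp: cinner_simps)
  qed
  then show ?thesis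
    by simp
qed

text \<open>Symmetry removes the cross term in the norm of \<open>g - \<i> *\<^sub>C f\<close>, so
  \<open>A - \<i>\<close> is bounded below and preimages of a convergent sequence are Cauchy; hence
  the range is closed. A vector \<open>w\<close> orthogonal to the range satisfies
  \<open>A w = - \<i> w\<close>, which forces \<open>w = 0\<close> by symmetry.\<close>

lemma self_adjoint_range:
  assumes "self_adjoint A"
  obtains f g where "(f, g) \<in> A" and "g - \<i> *\<^sub>C f = y"
proof -
  have lin: "linear_operator A" and adj: "adj A = A"
    using assms by (auto simp: self_adjoint_def)
  define M where "M = {g - \<i> *\<^sub>C f | f g. (f, g) \<in> A}"
  have below: "norm f \<le> norm (g - \<i> *\<^sub>C f)" if fg: "(f, g) \<in> A" for f g
  proof -
    have "cinner f g = cnj (cinner f g)"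
      using adjD[of f g A f g] cinner_commute[of g f] fg adj by simp
    then have "Im (cinner f g) = 0"
      by (simp add: complex_eq_iff)
    then have "(norm (g - \<i> *\<^sub>C f))\<^sup>2 = (norm g)\<^sup>2 + (norm f)\<^sup>2"
      by (simp add: norm_diff_scaleC_sq)
    then have "(norm f)\<^sup>2 \<le> (norm (g - \<i> *\<^sub>C f))\<^sup>2"
      by simp
    then show ?thesis
      by (rule power2_le_imp_le) simp
  qed
  have "M = UNIV"
  proof (rule closed_subspace_eq_UNIV)
    show "complex_vector.subspace M"
    proof (rule complex_vector.subspaceI)
      show "0 \<in> M"
        using lin unfolding M_def linear_operator_def
        by (intro CollectI exI[of _ 0]) simp
      show "x + y \<in> M" if xy: "x \<in> M" "y \<in> M" for x y
      proof -
        obtain f g h k where "(f, g) \<in> A" "(h, k) \<in> A"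
          and "x = g - \<i> *\<^sub>C f" "y = k - \<i> *\<^sub>C h"
          using xy unfolding M_def by blast
        moreover from this have "(f + h, g + k) \<in> A"
          using lin unfolding linear_operator_def by blast
        moreover have "x + y = (g + k) - \<i> *\<^sub>C (f + h)"
          using calculation by (simp add: scaleC_add_right)
        ultimately show ?thesis
          unfolding M_def by blast
      qed
      show "c *\<^sub>C x \<in> M" if x: "x \<in> M" for c x
      proof -
        obtain f g where "(f, g) \<in> A" and x_eq: "x = g - \<i> *\<^sub>C f"
          using x unfolding M_def by blast
        then have "(c *\<^sub>C f, c *\<^sub>C g) \<in> A"
          using lin unfolding linear_operator_def by blast
        moreover have "c *\<^sub>C x = c *\<^sub>C g - \<i> *\<^sub>C c *\<^sub>C f"
          by (simp add: x_eq complex_vector.scale_right_diff_distrib scaleC_scaleC mult.commute)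
        ultimately show ?thesis
          unfolding M_def by blast
      qed
    qed
    show "closed M"
      unfolding closed_sequential_limits
    proof (intro allI impI, elim conjE)
      fix s l
      assume s: "\<forall>n. s n \<in> M" "s \<longlonglongrightarrow> l"
      then have "\<forall>n. \<exists>f g. (f, g) \<in> A \<and> s n = g - \<i> *\<^sub>C f"
        unfolding M_def by blast
      then obtain p q where pq: "\<And>n. (p n, q n) \<in> A" "\<And>n. s n = q n - \<i> *\<^sub>C p n"
        by metis
      have "norm (p i - p j) \<le> norm (s i - s j)" for i j
      proof -
        have "(p i - p j, q i - q j) \<in> A"
          using adj_diff[of "p i" "q i" A "p j" "q j"] pq(1) adj by simp
        then show ?thesis
          using below[of "p i - p j" "q i - q j"]
          by (simp add: pq(2) complex_vector.scale_right_diff_distrib algebra_simps)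
      qed
      moreover have "Cauchy s"
        using s(2) by (simp add: LIMSEQ_imp_Cauchy)
      ultimately have "Cauchy p"
        unfolding Cauchy_iff by (meson order_le_less_trans)
      then obtain f where f: "p \<longlonglongrightarrow> f"
        using Cauchy_convergent convergent_def by blast
      have "norm (\<i> *\<^sub>C p n - \<i> *\<^sub>C f) = norm (p n - f)" for n
        by (simp add: norm_scaleC flip: complex_vector.scale_right_diff_distrib)
      then have "(\<lambda>n. \<i> *\<^sub>C p n) \<longlonglongrightarrow> \<i> *\<^sub>C f"
        using f by (simp add: tendsto_iff dist_norm)
      then have q: "q \<longlonglongrightarrow> l + \<i> *\<^sub>C f"
        using tendsto_add[OF s(2)] by (fastforce simp: pq(2))
      \<comment> \<open>The adjoint identity passes to the limit, so the limit pair lies in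
        \<open>adj A\<close>, which is \<open>A\<close>.\<close>
      have "cinner k f = cinner h (l + \<i> *\<^sub>C f)" if "(h, k) \<in> A" for h k
      proof (rule LIMSEQ_unique)
        show "(\<lambda>n. cinner k (p n)) \<longlonglongrightarrow> cinner k f"
          using f by (rule tendsto_cinner_right)
        have "cinner k (p n) = cinner h (q n)" for n
          using adjD[of "p n" "q n" A h k] pq(1) adj that by simp
        then show "(\<lambda>n. cinner k (p n)) \<longlonglongrightarrow> cinner h (l + \<i> *\<^sub>C f)"
          using tendsto_cinner_right[OF q] by simp
      qed
      then have "(f, l + \<i> *\<^sub>C f) \<in> A"
        using adj unfolding adj_def by blast
      then show "l \<in> M"
        unfolding M_def by force
    qed
    show "w = 0" if orth: "\<And>m. m \<in> M \<Longrightarrow> cinner m w = 0" for w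
    proof -
      have "cinner g w = cinner f ((-\<i>) *\<^sub>C w)" if "(f, g) \<in> A" for f g
      proof -
        have "cinner (g - \<i> *\<^sub>C f) w = 0"
          using that by (intro orth) (auto simp: M_def)
        then show ?thesis
          by (simp add: cinner_simps del: complex_vector.scale_minus_left)
      qed
      then have "(w, (-\<i>) *\<^sub>C w) \<in> A"
        using adj unfolding adj_def by blast
      then have "cinner ((-\<i>) *\<^sub>C w) w = cinner w ((-\<i>) *\<^sub>C w)"
        using adjD adj by metis
      then show ?thesis
        by (simp add: cinner_simps cinner_same complex_eq_iff del: complex_vector.scale_minus_left)
    qed
  qed
  then have "y \<in> M"
    by simp
  then show ?thesis
    using that unfolding M_def by blast
qed


lemma dim_1_multiple:
  fixes S :: "'a::complex_hilbert_space set"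
  assumes "complex_vector.dim S = 1" and "x \<in> S" and "x \<noteq> 0" and "y \<in> S"
  obtains c where "y = c *\<^sub>C x"
proof -
  obtain B where B: "S \<subseteq> complex_vector.span B" "card B = 1"
    using complex_vector.basis_exists[of S] assms(1) by metis
  then obtain b where "B = {b}"
    by (auto simp: card_1_singleton_iff)
  then obtain d e where d: "x = d *\<^sub>C b" and e: "y = e *\<^sub>C b"
    using B(1) assms(2,4) by (force simp: complex_vector.span_singleton)
  have "d \<noteq> 0"
    using d assms(3) by auto
  then have "y = (e / d) *\<^sub>C x"
    by (simp add: d e scaleC_scaleC)
  then show ?thesis
    using that by blast
qed

section \<open>The L-system\<close>

locale L_system_zero =
  fixes Adot :: "'a::complex_hilbert_space operator"
    and AA :: "'a \<Rightarrow> 'a \<Rightarrow> complex"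
    and K :: "complex \<Rightarrow> 'a \<Rightarrow> complex"
  assumes dense: "densely_defined Adot"
    and deficiency: "deficiency_indices_1_1 Adot"
    and L_system: "L_system Adot AA K"
    and hypothesis_H:
      "hypothesis_H Adot (main_operator Adot AA) (quasi_kernel Adot (bi_Re Adot AA)) 0"
begin

abbreviation "H \<equiv> Hplus Adot"
abbreviation "T \<equiv> main_operator Adot AA"
abbreviation "Ahat \<equiv> quasi_kernel Adot (bi_Re Adot AA)"
abbreviation "k \<equiv> K 1"

section \<open>The form \<open>AA\<close> and its relation to \<open>T\<close>, \<open>Ahat\<close>
  and \<open>adj Adot\<close>\<close>

lemma HplusI: "(f, g) \<in> adj Adot \<Longrightarrow> f \<in> H"
  by (auto simp: Hplus_def)

lemma Hplus_diff: "f \<in> H \<Longrightarrow> g \<in> H \<Longrightarrow> f - g \<in> H"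
  using adj_diff by (force simp: Hplus_def)

lemma Hplus_scaleC: "f \<in> H \<Longrightarrow> c *\<^sub>C f \<in> H"
  using adj_scaleC by (force simp: Hplus_def)

lemma AA_bounded: "AA \<in> bounded_plus_minus Adot"
  using L_system by (auto simp: L_system_def star_extension_def)

lemma AA_add: "f \<in> H \<Longrightarrow> g \<in> H \<Longrightarrow> AA (f + g) u = AA f u + AA g u"
  using AA_bounded by (auto simp: bounded_plus_minus_def)

lemma AA_scaleC: "f \<in> H \<Longrightarrow> AA (c *\<^sub>C f) u = c * AA f u"
  using AA_bounded by (auto simp: bounded_plus_minus_def)

lemma AA_diff: "f \<in> H \<Longrightarrow> g \<in> H \<Longrightarrow> AA (f - g) u = AA f u - AA g u"
  using AA_add[of "f - g" g u] Hplus_diff by simp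

lemma AA_outside: "f \<in> H \<Longrightarrow> u \<notin> H \<Longrightarrow> AA f u = 0"
  using AA_bounded by (auto simp: bounded_plus_minus_def Hminus_def)

lemma k_outside: "u \<notin> H \<Longrightarrow> k u = 0"
  using L_system by (auto simp: L_system_def bounded_complex_minus_def Hminus_def)

text \<open>The identity Im AA = K K* in rank-one form: the two arguments of \<open>AA\<close> may
  be exchanged at the price of a multiple of \<open>k\<close>.\<close>

lemma AA_skew:
  assumes "f \<in> H" and "u \<in> H"
  shows "AA f u = cnj (AA u f) + 2 * \<i> * cnj (k f) * k u"
proof -
  \<comment> \<open>The factor 1 exposes the homogeneity of \<open>K\<close>, which reduces it to
    \<open>K 1\<close>.\<close>
  have "bi_Im Adot AA f u = K (channel_adj K f * 1) u"
    using L_system assms by (simp add: L_system_def)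
  also have "\<dots> = channel_adj K f * k u"
    using L_system unfolding L_system_def bounded_complex_minus_def mem_Collect_eq by metis
  finally show ?thesis
    using assms by (simp add: bi_Im_def bi_adj_def channel_adj_def field_simps)
qed

lemma main_operator_iff: "(f, g) \<in> T \<longleftrightarrow> f \<in> H \<and> (\<forall>u\<in>H. AA f u = cinner g u)"
  using AA_outside by (auto simp: main_operator_def emb_def fun_eq_iff)

text \<open>Here AA = Re AA + i Im AA: the real part acts as \<open>Ahat\<close>, the imaginary part
  adds the multiple of \<open>k\<close>.\<close>

lemma quasi_kernel_AA:
  assumes "(a, b) \<in> Ahat"
  shows "a \<in> H" and "u \<in> H \<Longrightarrow> AA a u = cinner b u + \<i> * cnj (k a) * k u"
proof -
  show a: "a \<in> H"
    using assms by (simp add: quasi_kernel_def)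
  assume u: "u \<in> H"
  have "bi_Re Adot AA a u = cinner b u"
    using assms u by (simp add: quasi_kernel_def emb_def)
  then have "AA a u + cnj (AA u a) = 2 * cinner b u"
    using a u by (simp add: bi_Re_def bi_adj_def)
  then show "AA a u = cinner b u + \<i> * cnj (k a) * k u"
    using AA_skew[OF a u] by algebra
qed

text \<open>The adjoint of \<open>AA\<close> extends \<open>adj T'\<close>, which contains
  \<open>Adot\<close>; so pairing \<open>AA f\<close> with an element of the domain of
  \<open>Adot\<close> moves \<open>AA\<close> over to \<open>Adot\<close>.\<close>

lemma main_operator_subset: "T \<subseteq> adj Adot"
proof -
  obtain T' where "Adot \<subseteq> adj T'" and T': "bi_extends Adot (bi_adj Adot AA) (adj T')"
    using L_system unfolding L_system_def star_extension_def by blast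
  have "cinner v f = cinner u g" if fg: "(f, g) \<in> T" and uv: "(u, v) \<in> Adot" for f g u v
  proof -
    have f: "f \<in> H" and u: "u \<in> H" and "bi_adj Adot AA u = emb Adot v"
      using fg uv T' \<open>Adot \<subseteq> adj T'\<close> by (auto simp: main_operator_iff bi_extends_def)
    then have "cinner v f = cnj (AA f u)"
      by (metis bi_adj_def emb_def)
    then show ?thesis
      using fg u cinner_commute[of u g] by (simp add: main_operator_iff)
  qed
  then show ?thesis
    unfolding adj_def by blast
qed

lemma Ahat_self_adjoint: "self_adjoint Ahat"
  using hypothesis_H by (simp add: hypothesis_H_def)

lemma Ahat_subset: "Ahat \<subseteq> adj Adot"
  using hypothesis_H adj_antimono[of Adot Ahat]
  by (auto simp: hypothesis_H_def self_adjoint_def)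

lemma deficiency_i_multiple:
  assumes "x \<in> deficiency_space Adot \<i>" and "x \<noteq> 0" and "y \<in> deficiency_space Adot \<i>"
  obtains c where "y = c *\<^sub>C x"
  using dim_1_multiple assms deficiency unfolding deficiency_indices_1_1_def by metis

text \<open>This is where the von Neumann parameter 0 enters: (H) puts the \<open>gp0\<close> of one
  pair itself into the domain of \<open>T\<close>. Deficiency index 1 carries this to every other
  pair.\<close>

lemma normalized_deficiency_pair_main_operator:
  assumes "normalized_deficiency_pair Adot Ahat gp gm"
  shows "(gp, \<i> *\<^sub>C gp) \<in> T"
proof -
  obtain gp0 gm0 where pair0: "normalized_deficiency_pair Adot Ahat gp0 gm0" and "gp0 \<in> Domain T"
    using hypothesis_H by (auto simp: hypothesis_H_def)
  then obtain v where v: "(gp0, v) \<in> T"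
    by blast
  have "gp0 \<noteq> 0" and gp0: "(gp0, \<i> *\<^sub>C gp0) \<in> adj Adot" "gp0 \<in> deficiency_space Adot \<i>"
    using pair0 by (auto simp: normalized_deficiency_pair_def deficiency_space_def)
  then have "v = \<i> *\<^sub>C gp0"
    using adj_single_valued[OF dense] v main_operator_subset by blast
  then have T0: "(gp0, \<i> *\<^sub>C gp0) \<in> T"
    using v by simp
  obtain c where "gp = c *\<^sub>C gp0"
    using deficiency_i_multiple[OF gp0(2) \<open>gp0 \<noteq> 0\<close>] assms
    by (auto simp: normalized_deficiency_pair_def)
  then show ?thesis
    using T0 by (auto simp: main_operator_iff Hplus_scaleC AA_scaleC cinner_simps)
qed

text \<open>\<open>Ahat\<close> is a restriction of \<open>adj Adot\<close>, which acts on
  \<open>gp\<close> as i and on \<open>gm\<close> as -i.\<close>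

lemma normalized_deficiency_pair_quasi_kernel:
  assumes "normalized_deficiency_pair Adot Ahat gp gm"
  shows "(gp - gm, \<i> *\<^sub>C (gp + gm)) \<in> Ahat"
proof -
  obtain v where v: "(gp - gm, v) \<in> Ahat"
    using assms by (auto simp: normalized_deficiency_pair_def)
  have "(gp - gm, \<i> *\<^sub>C gp - (- \<i>) *\<^sub>C gm) \<in> adj Adot"
    using assms adj_diff[of gp "\<i> *\<^sub>C gp" Adot gm "(- \<i>) *\<^sub>C gm"]
    by (simp add: normalized_deficiency_pair_def deficiency_space_def)
  then have "v = \<i> *\<^sub>C gp - (- \<i>) *\<^sub>C gm"
    using adj_single_valued[OF dense] v Ahat_subset by blast
  then show ?thesis
    using v by (simp add: scaleC_add_right)
qed

lemma pair_exists: obtains gp gm where "normalized_deficiency_pair Adot Ahat gp gm"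
  using hypothesis_H by (auto simp: hypothesis_H_def)

text \<open>On all of \<open>H\<close> the form \<open>AA\<close> deviates from
  \<open>adj Adot\<close> only in the direction \<open>k\<close>, so solving an equation with right
  side \<open>k\<close> becomes a matter of scaling.\<close>

lemma AA_eq_adj_plus_multiple:
  assumes "(f, g) \<in> adj Adot"
  obtains c where "\<And>u. u \<in> H \<Longrightarrow> AA f u = cinner g u + c * k u"
proof -
  obtain gp gm where pair: "normalized_deficiency_pair Adot Ahat gp gm"
    by (rule pair_exists)
  have gp: "gp \<in> deficiency_space Adot \<i>" "gp \<noteq> 0"
    using pair by (auto simp: normalized_deficiency_pair_def)
  \<comment> \<open>Choosing \<open>a\<close> with \<open>(Ahat - \<i>) a\<close> equal to
    \<open>(adj Adot - \<i>) f\<close> makes \<open>f - a\<close> a deficiency element for i. There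
    \<open>AA\<close> acts without a \<open>k\<close> term, so the constant comes from
    \<open>a\<close> alone.\<close>
  obtain a b where ab: "(a, b) \<in> Ahat" "b - \<i> *\<^sub>C a = g - \<i> *\<^sub>C f"
    by (rule self_adjoint_range[OF Ahat_self_adjoint])
  have gb: "g - b = \<i> *\<^sub>C (f - a)"
    using ab(2) by (simp add: complex_vector.scale_right_diff_distrib algebra_simps)
  have "(f - a, g - b) \<in> adj Adot"
    using assms ab(1) Ahat_subset by (auto intro: adj_diff)
  then have "f - a \<in> deficiency_space Adot \<i>"
    by (simp add: gb deficiency_space_def)
  then obtain d where d: "f - a = d *\<^sub>C gp"
    using deficiency_i_multiple[OF gp] by blast
  have T: "(gp, \<i> *\<^sub>C gp) \<in> T"
    by (rule normalized_deficiency_pair_main_operator[OF pair])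
  have "AA f u = cinner g u + (\<i> * cnj (k a)) * k u" if u: "u \<in> H" for u
  proof -
    have "AA f u - AA a u = AA (f - a) u"
      using AA_diff HplusI[OF assms] quasi_kernel_AA(1)[OF ab(1)] by simp
    also have "\<dots> = cinner (g - b) u"
      using T u by (simp add: gb d main_operator_iff AA_scaleC cinner_simps)
    finally show ?thesis
      using quasi_kernel_AA(2)[OF ab(1) u] by (simp add: cinner_simps algebra_simps)
  qed
  then show ?thesis
    using that by blast
qed

section \<open>Solving \<open>(AA - z) f = k\<close> by deficiency elements\<close>

lemma resolvent_kernel:
  assumes "z \<in> resolvent_set T" and "(f, z *\<^sub>C f) \<in> T"
  shows "f = 0"
proof -
  \<comment> \<open>This is the defining property of the resolvent set for the right side 0, which
    the zero vector also solves.\<close>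
  have "\<exists>!f. (f, 0 + z *\<^sub>C f) \<in> T"
    using assms(1) by (simp only: resolvent_set_def mem_Collect_eq)
  moreover have "(0, 0 + z *\<^sub>C 0) \<in> T"
    using assms(2) Hplus_scaleC[of f 0] AA_scaleC[of f 0]
    by (simp add: main_operator_iff)
  ultimately show ?thesis
    using assms(2) by force
qed

lemma bi_resolvent_eq:
  assumes z: "z \<in> resolvent_set T" and g: "g \<in> deficiency_space Adot z" "g \<noteq> 0"
  obtains c where "c \<noteq> 0" and "bi_resolvent Adot AA z k = c *\<^sub>C g"
    and "\<And>u. u \<in> H \<Longrightarrow> AA (c *\<^sub>C g) u = z * cinner (c *\<^sub>C g) u + k u"
proof -
  have adj: "(g, z *\<^sub>C g) \<in> adj Adot"
    using g by (simp add: deficiency_space_def)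
  obtain d where d: "\<And>u. u \<in> H \<Longrightarrow> AA g u = cinner (z *\<^sub>C g) u + d * k u"
    using AA_eq_adj_plus_multiple[OF adj] by blast
  have gH: "g \<in> H"
    by (rule HplusI[OF adj])
  \<comment> \<open>If \<open>d\<close> were 0, \<open>g\<close> would be an eigenvector of
    \<open>T\<close> at a point of its resolvent set.\<close>
  have "d \<noteq> 0"
    using resolvent_kernel[OF z, of g] g(2) d gH by (auto simp: main_operator_iff)
  define f where "f = (1 / d) *\<^sub>C g"
  have f: "AA f u = z * cinner f u + k u" if "u \<in> H" for u
    using gH that \<open>d \<noteq> 0\<close> by (simp add: f_def AA_scaleC cinner_simps d field_simps)
  have fH: "f \<in> H"
    by (simp add: f_def gH Hplus_scaleC)
  have "bi_resolvent Adot AA z k = f"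
    unfolding bi_resolvent_def
  proof (rule the_equality)
    show "f \<in> H \<and> (\<lambda>u. AA f u - z * emb Adot f u) = k"
      using fH f AA_outside k_outside by (auto simp: emb_def fun_eq_iff)
    \<comment> \<open>The \<open>k\<close> terms of two solutions cancel, so their difference lies
      in the kernel of \<open>T - z\<close>.\<close>
    show "h = f" if h: "h \<in> H \<and> (\<lambda>u. AA h u - z * emb Adot h u) = k" for h
    proof -
      have "AA h u = z * cinner h u + k u" if "u \<in> H" for u
        using conjunct2[OF h, THEN fun_cong, of u] that by (simp add: emb_def algebra_simps)
      then have "(h - f, z *\<^sub>C (h - f)) \<in> T"
        using h fH f by (simp add: main_operator_iff Hplus_diff AA_diff cinner_simps algebra_simps)
      then show ?thesis
        using resolvent_kernel[OF z] by fastforce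
    qed
  qed
  then show ?thesis
    using that[of "1 / d"] \<open>d \<noteq> 0\<close> f by (simp add: f_def)
qed

text \<open>The resolvent of \<open>T\<close> corrects \<open>gm\<close>: if
  \<open>(T - z) t = (adj Adot - z) gm\<close>, then \<open>gm - t\<close> is a deficiency element
  at \<open>z\<close>. It is nonzero, since otherwise \<open>T gm = - \<i> gm\<close>, against
  dissipativity.\<close>

lemma deficiency_space_nontrivial:
  assumes "z \<in> resolvent_set T"
  obtains g where "g \<in> deficiency_space Adot z" and "g \<noteq> 0"
proof -
  obtain gp gm where pair: "normalized_deficiency_pair Adot Ahat gp gm"
    by (rule pair_exists)
  then have gm: "(gm, (- \<i>) *\<^sub>C gm) \<in> adj Adot" "norm gm = 1"
    by (auto simp: normalized_deficiency_pair_def deficiency_space_def)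
  define y where "y = (- \<i>) *\<^sub>C gm - z *\<^sub>C gm"
  obtain t where t: "(t, y + z *\<^sub>C t) \<in> T"
    using assms unfolding resolvent_set_def by blast
  have "(gm - t, (- \<i>) *\<^sub>C gm - (y + z *\<^sub>C t)) \<in> adj Adot"
    using adj_diff[OF gm(1)] t main_operator_subset by blast
  then have "gm - t \<in> deficiency_space Adot z"
    by (simp add: deficiency_space_def y_def complex_vector.scale_right_diff_distrib)
  moreover have "gm \<noteq> t"
  proof
    assume "gm = t"
    then have "(gm, (- \<i>) *\<^sub>C gm) \<in> T"
      using t by (simp add: y_def)
    then have "Im (cinner ((- \<i>) *\<^sub>C gm) gm) \<ge> 0"
      using hypothesis_H
      unfolding hypothesis_H_def maximal_dissipative_extension_def dissipative_def by blast
    then show False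
      using gm(2) by (simp add: cinner_scaleC_left cinner_same del: complex_vector.scale_minus_left)
  qed
  ultimately show ?thesis
    using that by simp
qed

text \<open>Comparing the values of \<open>AA\<close> on \<open>gp\<close> and \<open>gp - gm\<close> gives \<open>cmod (k gp) = 1\<close> and
  \<open>k (gp - gm) = 2 * k gp\<close>.\<close>

lemma resolvent_deficiency_products:
  assumes pair: "normalized_deficiency_pair Adot Ahat gp gm" and f: "f \<in> H"
    and eq: "\<And>u. u \<in> H \<Longrightarrow> AA f u = z * cinner f u + k u"
  shows "k gp \<noteq> 0"
    and "- (z + \<i>) * cinner f gp = k gp * (1 - 2 * \<i> * cnj (k f))"
    and "(z - \<i>) * cinner f gm = k gp"
proof -
  define h where "h = gp - gm"
  have T: "(gp, \<i> *\<^sub>C gp) \<in> T"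
    by (rule normalized_deficiency_pair_main_operator[OF pair])
  have A: "(h, \<i> *\<^sub>C (gp + gm)) \<in> Ahat"
    unfolding h_def by (rule normalized_deficiency_pair_quasi_kernel[OF pair])
  have gp: "gp \<in> H" and AA_gp: "\<And>u. u \<in> H \<Longrightarrow> AA gp u = \<i> * cinner gp u"
    using T by (auto simp: main_operator_iff cinner_simps)
  have h: "h \<in> H"
    and AA_h: "\<And>u. u \<in> H \<Longrightarrow> AA h u = \<i> * cinner (gp + gm) u + \<i> * cnj (k h) * k u"
    using quasi_kernel_AA[OF A] by (auto simp: cinner_simps)
  have one: "cinner gp gp = 1"
    using pair by (simp add: normalized_deficiency_pair_def cinner_same)
  \<comment> \<open>\<open>AA_skew\<close> at \<open>(gp, gp)\<close> reads i = -i + 2i |k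
    gp|^2.\<close>
  have k_gp: "cnj (k gp) * k gp = 1"
    using AA_skew[OF gp gp] by (simp add: AA_gp gp one complex_eq_iff)
  then show "k gp \<noteq> 0"
    by auto
  \<comment> \<open>\<open>AA_skew\<close> at \<open>(h, gp)\<close>; the unknown product
    \<open>cinner gm gp\<close> occurs on both sides and cancels.\<close>
  have "\<i> * cinner (gp + gm) gp + \<i> * cnj (k h) * k gp
      = cnj (\<i> * cinner gp h) + 2 * \<i> * cnj (k h) * k gp"
    using AA_skew[OF h gp] AA_h[OF gp] AA_gp[OF h] by simp
  moreover have "cnj (cinner gp h) = 1 - cinner gm gp"
    using cinner_commute[of h gp] by (simp add: h_def cinner_simps one)
  ultimately have "\<i> * (cnj (k h) * k gp) = \<i> * 2"
    by (simp add: cinner_simps one algebra_simps)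
  then have "cnj (k h) * k gp = 2"
    by (metis complex_i_not_zero mult_cancel_left)
  \<comment> \<open>Since \<open>k gp\<close> is unimodular, conjugating and multiplying by it
    isolates \<open>k h\<close>.\<close>
  then have "cnj (cnj (k h) * k gp) * k gp = 2 * k gp"
    by simp
  then have k_h: "k h = 2 * k gp"
    using k_gp by (simp add: mult.assoc)
  show W: "- (z + \<i>) * cinner f gp = k gp * (1 - 2 * \<i> * cnj (k f))"
    using AA_skew[OF f gp] eq[OF gp] AA_gp[OF f] cinner_commute[of f gp]
    by (simp add: algebra_simps)
  have f_h: "cinner f h = cinner f gp - cinner f gm"
    by (simp add: h_def cinner_simps)
  have "cnj (cinner (gp + gm) f) = cinner f gp + cinner f gm"
    using cinner_commute[of f "gp + gm"] by (simp add: cinner_simps)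
  \<comment> \<open>\<open>AA_skew\<close> at \<open>(f, h)\<close>; the \<open>k\<close> term of
    \<open>AA h\<close> cancels half of the rank-one term. Subtracting \<open>W\<close> then removes
    \<open>cinner f gp\<close> and \<open>k f\<close>.\<close>
  then have "z * (cinner f gp - cinner f gm) + 2 * k gp
      = - \<i> * (cinner f gp + cinner f gm) + \<i> * cnj (k f) * (2 * k gp)"
    using AA_skew[OF f h] eq[OF h] AA_h[OF f] by (simp add: k_h f_h algebra_simps)
  then show "(z - \<i>) * cinner f gm = k gp"
    using W by algebra
qed

text \<open>If the transfer function vanishes at \<open>z\<close>, then so does \<open>cinner g gp\<close>, and both sides
  are 0 by \<open>x / 0 = 0\<close>.\<close>

lemma livsic_transfer_function:
  assumes z: "z \<in> resolvent_set T" "Im z > 0"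
    and pair: "normalized_deficiency_pair Adot Ahat gp gm"
    and g: "g \<in> deficiency_space Adot z" "g \<noteq> 0"
  shows "- 1 / transfer_function Adot AA K z
    = (z - \<i>) / (z + \<i>) * (cinner g gm / cinner g gp)"
proof -
  obtain c where c: "c \<noteq> 0" "bi_resolvent Adot AA z k = c *\<^sub>C g"
    and eq: "\<And>u. u \<in> H \<Longrightarrow> AA (c *\<^sub>C g) u = z * cinner (c *\<^sub>C g) u + k u"
    using bi_resolvent_eq[OF z(1) g] by blast
  define f where "f = c *\<^sub>C g"
  define W where "W = transfer_function Adot AA K z"
  have f: "f \<in> H"
    unfolding f_def using g(1) by (auto simp: deficiency_space_def intro: Hplus_scaleC HplusI)
  have W: "W = 1 - 2 * \<i> * cnj (k f)"
    by (simp add: W_def transfer_function_def channel_adj_def c(2) f_def)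
  note products = resolvent_deficiency_products[OF pair f eq[folded f_def], folded W]
  have "z + \<i> \<noteq> 0"
    using z(2) by (auto simp: complex_eq_iff)
  have "- 1 / W = - k gp / (k gp * W)"
    using products(1) by simp
  also have "\<dots> = ((z - \<i>) * cinner f gm) / ((z + \<i>) * cinner f gp)"
    using products(2,3) by (metis minus_divide_divide minus_minus mult_minus_left)
  \<comment> \<open>The scaling factor \<open>c\<close> cancels in the ratio.\<close>
  also have "\<dots> = (z - \<i>) / (z + \<i>) * (cinner g gm / cinner g gp)"
    using c(1) by (simp add: f_def cinner_scaleC_left)
  finally show ?thesis
    by (simp add: W_def)
qed

lemma livsic_eq:
  assumes "z \<in> resolvent_set T" and "Im z > 0"
  shows "livsic Adot Ahat z = - 1 / transfer_function Adot AA K z"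
  unfolding livsic_def
proof (rule the_equality)
  show "\<forall>gp gm gz. normalized_deficiency_pair Adot Ahat gp gm \<longrightarrow>
      gz \<in> deficiency_space Adot z \<longrightarrow> gz \<noteq> 0 \<longrightarrow>
      - 1 / transfer_function Adot AA K z = (z - \<i>) / (z + \<i>) * (cinner gz gm / cinner gz gp)"
    using livsic_transfer_function[OF assms] by blast
  \<comment> \<open>One admissible choice of vectors makes the universal condition non-vacuous,
    which gives uniqueness in the description.\<close>
  obtain gp gm g where "normalized_deficiency_pair Adot Ahat gp gm"
    and "g \<in> deficiency_space Adot z" "g \<noteq> 0"
    using pair_exists deficiency_space_nontrivial[OF assms(1)] by metis
  then show "s = - 1 / transfer_function Adot AA K z"
    if "\<forall>gp gm gz. normalized_deficiency_pair Adot Ahat gp gm \<longrightarrow>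
      gz \<in> deficiency_space Adot z \<longrightarrow> gz \<noteq> 0 \<longrightarrow>
      s = (z - \<i>) / (z + \<i>) * (cinner gz gm / cinner gz gp)" for s
    using that livsic_transfer_function[OF assms] by metis
qed

end

theorem corollary8:
  fixes Adot :: "'a::complex_hilbert_space operator"
    and AA :: "'a \<Rightarrow> 'a \<Rightarrow> complex"
    and K :: "complex \<Rightarrow> 'a \<Rightarrow> complex"
  assumes "closed Adot" and "densely_defined Adot" and "symmetric_operator Adot"
    and "deficiency_indices_1_1 Adot"
    and "L_system Adot AA K"
    and "hypothesis_H Adot (main_operator Adot AA) (quasi_kernel Adot (bi_Re Adot AA)) 0"
  shows "\<forall>z \<in> {z. Im z > 0} \<inter> resolvent_set (main_operator Adot AA).
           transfer_function Adot AA K z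
             = - 1 / livsic Adot (quasi_kernel Adot (bi_Re Adot AA)) z"
proof -
  interpret L_system_zero Adot AA K
    using assms by unfold_locales
  show ?thesis
    \<comment> \<open>Taking -1/x twice returns x, also for a vanishing transfer function, because
      1/0 is 0.\<close>
    by (auto simp: livsic_eq)
qed

end
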